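(* If $G$ is a connected graph of order $n\geq 2$ and $uv\in E(G)$, then $b_{dR}(G)\leq \deg_G(u)+\deg_G(v)-1-|N(u)\cap N(v)|$.
   Context: All graphs are finite, simple and undirected. $N(v)$ is the open neighborhood of $v$ and $\deg_G(v)=|N(v)|$. For a graph $G=(V,E)$, a double Roman dominating function (DRDF) is a function $f:V\to\{0,1,2,3\}$ such that every vertex $v$ with $f(v)=0$ has at least two neighbors $u$ with $f(u)=2$ or at least one neighbor $w$ with $f(w)=3$, and every vertex $v$ with $f(v)=1$ has at least one neighbor $w$ with $f(w)\geq 2$. The weight of $f$ is $\sum_{u\in V}f(u)$, and $\gamma_{dR}(G)$ is the minimum weight of a DRDF on $G$. The double Roman bondage number $b_{dR}(G)$ is the minimum cardinality of an edge set $B\subseteq E(G)$ such that $\gamma_{dR}(G-B)>\gamma_{dR}(G)$. *)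

theory Defs
  imports Main "HOL-Library.FuncSet" "HOL-Library.Extended_Nat"
begin

locale fin_simple_graph =
  fixes V :: "'a set" and E :: "'a set set"
  assumes finite_vertices: "finite V"
    and edges: "E \<subseteq> {e. e \<subseteq> V \<and> card e = 2}"

definition neighborhood :: "'a set set \<Rightarrow> 'a \<Rightarrow> 'a set" where
  "neighborhood E v = {u. {u, v} \<in> E}"

definition degree :: "'a set set \<Rightarrow> 'a \<Rightarrow> nat" where
  "degree E v = card (neighborhood E v)"

definition connected_graph :: "'a set \<Rightarrow> 'a set set \<Rightarrow> bool" where
  "connected_graph V E \<longleftrightarrow>
     V \<noteq> {} \<and> (\<forall>x\<in>V. \<forall>y\<in>V. (x, y) \<in> {(a, b). {a, b} \<in> E}\<^sup>*)"

definition drdf :: "'a set \<Rightarrow> 'a set set \<Rightarrow> ('a \<Rightarrow> nat) \<Rightarrow> bool" where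
  "drdf V E f \<longleftrightarrow>
     f \<in> V \<rightarrow> {0, 1, 2, 3} \<and>
     (\<forall>v\<in>V. f v = 0 \<longrightarrow>
        card {u \<in> neighborhood E v. f u = 2} \<ge> 2 \<or> (\<exists>w\<in>neighborhood E v. f w = 3)) \<and>
     (\<forall>v\<in>V. f v = 1 \<longrightarrow> (\<exists>w\<in>neighborhood E v. f w \<ge> 2))"

definition gamma_dR :: "'a set \<Rightarrow> 'a set set \<Rightarrow> nat" where
  "gamma_dR V E = (LEAST w. \<exists>f. drdf V E f \<and> w = (\<Sum>u\<in>V. f u))"

lemma drdf_const_2: "drdf V E (\<lambda>_. 2)"
  by (auto simp: drdf_def)

lemma gamma_dR_attained: "\<exists>f. drdf V E f \<and> gamma_dR V E = (\<Sum>u\<in>V. f u)"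
  unfolding gamma_dR_def by (rule LeastI_ex) (use drdf_const_2 in blast)

lemma gamma_dR_le: "drdf V E f \<Longrightarrow> gamma_dR V E \<le> (\<Sum>u\<in>V. f u)"
  unfolding gamma_dR_def by (rule Least_le) blast

text \<open>The value is \<open>\<infinity>\<close> if no edge set qualifies (for instance in an edgeless graph), so a
  finite upper bound on \<open>b_dR V E\<close> includes the existence of a qualifying set.\<close>

definition b_dR :: "'a set \<Rightarrow> 'a set set \<Rightarrow> enat" where
  "b_dR V E = Inf {enat (card B) | B. B \<subseteq> E \<and> gamma_dR V (E - B) > gamma_dR V E}"

end

theory Submission
  imports Defs
begin

text \<open>
  Delete all edges at \<open>v\<close> and all edges from \<open>u\<close> to vertices outside \<open>N(v)\<close>. Then \<open>v\<close> is isolated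
  and the remaining neighbours of \<open>u\<close> are the common neighbours of \<open>u\<close> and \<open>v\<close>. Given a minimum
  DRDF \<open>f\<close> of what is left, \<open>f v \<ge> 2\<close>. If \<open>f u \<le> 1\<close>, then the neighbours defending \<open>u\<close> also defend
  \<open>v\<close> in \<open>G\<close>, so the value at \<open>v\<close> can be lowered to \<open>f u\<close>. If \<open>f u \<ge> 2\<close>, then giving \<open>3\<close> to \<open>u\<close> and
  \<open>0\<close> to \<open>v\<close> is cheaper. Either way \<open>G\<close> has a DRDF of smaller weight.
\<close>

text \<open>The value \<open>c\<close> is separate from \<open>f\<close>, and the neighborhood is an
  arbitrary set, so that a defense can be transferred to another vertex or another graph.\<close>

definition defended :: "'a set \<Rightarrow> ('a \<Rightarrow> nat) \<Rightarrow> nat \<Rightarrow> bool" where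
  "defended N f c \<longleftrightarrow>
     (c = 0 \<longrightarrow> card {u \<in> N. f u = 2} \<ge> 2 \<or> (\<exists>w\<in>N. f w = 3)) \<and>
     (c = 1 \<longrightarrow> (\<exists>w\<in>N. f w \<ge> 2))"

lemma drdf_iff_defended:
  "drdf V E f \<longleftrightarrow> (\<forall>x\<in>V. f x \<le> 3 \<and> defended (neighborhood E x) f (f x))"
proof -
  have "f x \<in> {0, 1, 2, 3} \<longleftrightarrow> f x \<le> 3" for x
    by auto
  then show ?thesis
    unfolding drdf_def defended_def Pi_def by blast
qed

text \<open>If raising \<open>f\<close> to \<open>g\<close> on \<open>N\<close> produces a 3, that
  neighbor defends alone; otherwise every 2 in \<open>N\<close> stays a 2 and no 3 was there before.
  The value \<open>c\<close> stays fixed.\<close>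

lemma defended_mono:
  assumes "defended N f c" "N \<subseteq> N'" "finite N'"
    and ge: "\<And>y. y \<in> N \<Longrightarrow> f y \<le> g y" and le3: "\<And>y. y \<in> N \<Longrightarrow> g y \<le> 3"
  shows "defended N' g c"
proof -
  have "card {y \<in> N'. g y = 2} \<ge> 2 \<or> (\<exists>w\<in>N'. g w = 3)"
    if "card {y \<in> N. f y = 2} \<ge> 2 \<or> (\<exists>w\<in>N. f w = 3)"
  proof (cases "\<exists>w\<in>N. g w = 3")
    case True
    then show ?thesis using assms(2) by blast
  next
    case False
    have "g y = 2" if "y \<in> N" "f y = 2" for y
      using ge[of y] le3[of y] False that by (metis le_antisym not_less_eq_eq numeral_2_eq_2 numeral_3_eq_3)
    then have "{y \<in> N. f y = 2} \<subseteq> {y \<in> N'. g y = 2}"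
      using assms(2) by blast
    then have "card {y \<in> N. f y = 2} \<le> card {y \<in> N'. g y = 2}"
      using assms(3) by (intro card_mono) auto
    moreover have "\<not> (\<exists>w\<in>N. f w = 3)"
      using ge le3 False by (metis le_antisym)
    ultimately show ?thesis
      using that by linarith
  qed
  moreover have "\<exists>w\<in>N'. g w \<ge> 2" if "\<exists>w\<in>N. f w \<ge> 2"
    using that ge assms(2) by (meson order_trans subsetD)
  ultimately show ?thesis
    using assms(1) unfolding defended_def by blast
qed

lemma (in fin_simple_graph) neighborhood_subset: "neighborhood E x \<subseteq> V"
  using edges unfolding neighborhood_def by auto

lemma (in fin_simple_graph) not_in_own_neighborhood: "x \<notin> neighborhood E x"
  using edges unfolding neighborhood_def by auto

lemma (in fin_simple_graph) finite_neighborhood: "finite (neighborhood E x)"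
  using finite_subset[OF neighborhood_subset finite_vertices] .

lemma (in fin_simple_graph) gamma_dR_less_if_isolated:
  assumes "E' \<subseteq> E" and uv: "{u, v} \<in> E"
    and iso: "neighborhood E' v = {}"
    and nu: "neighborhood E' u \<subseteq> neighborhood E v"
  shows "gamma_dR V E < gamma_dR V E'"
proof -
  obtain f where f: "drdf V E' f" and gamma: "gamma_dR V E' = sum f V"
    using gamma_dR_attained by blast
  have u: "u \<in> V" and v: "v \<in> V" and "u \<noteq> v"
    using uv edges by auto
  have sub: "neighborhood E' x \<subseteq> neighborhood E x" for x
    using assms(1) unfolding neighborhood_def by blast
  have v_notin: "v \<notin> neighborhood E' x" for x
    using iso unfolding neighborhood_def by (auto simp: insert_commute)
  have in_V: "y \<in> V" if "y \<in> neighborhood E' x" for x y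
    using that sub neighborhood_subset by blast
  have le3: "f x \<le> 3" and def: "defended (neighborhood E' x) f (f x)" if "x \<in> V" for x
    using f that unfolding drdf_iff_defended by auto
  \<comment> \<open>The values 0 and 1 both require a neighbor, and \<open>v\<close> has none in
    \<open>E'\<close>.\<close>
  have "f v \<ge> 2"
    using def[OF v] iso unfolding defended_def by (cases "f v"; cases "f v - 1") auto
  have sum_split: "sum h V = h u + (h v + sum h (V - {u, v}))" for h :: "'a \<Rightarrow> nat"
  proof -
    have "V - {u} - {v} = V - {u, v}"
      by blast
    then show ?thesis
      using sum.remove[OF finite_vertices u, of h] sum.remove[of "V - {u}" v h]
        finite_vertices v \<open>u \<noteq> v\<close> by simp
  qed
  \<comment> \<open>Since \<open>v\<close> is isolated in \<open>E'\<close>, it defends no vertex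
    there, so \<open>g v\<close> is unrestricted and may drop below \<open>f v\<close>.\<close>
  have keep: "defended (neighborhood E x) g (f x)"
    if "x \<in> V" "\<And>y. y \<in> V \<Longrightarrow> y \<noteq> v \<Longrightarrow> f y \<le> g y \<and> g y \<le> 3" for x g
    using defended_mono[OF def[OF that(1)] sub finite_neighborhood] that(2) in_V v_notin
    by metis
  have "\<exists>g. drdf V E g \<and> sum g V < sum f V"
  proof (cases "f u \<le> 1")
    case True
    define g where "g = f(v := f u)"
    \<comment> \<open>By \<open>nu\<close>, whatever defends \<open>u\<close> in \<open>E'\<close>
      is adjacent to \<open>v\<close> in \<open>E\<close>; it is not \<open>v\<close> itself, so its
      value is unchanged.\<close>
    have "defended (neighborhood E v) g (f u)"
      using defended_mono[OF def[OF u] nu finite_neighborhood, of g] in_V v_notin le3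
      unfolding g_def by (metis fun_upd_other order_refl)
    then have "drdf V E g"
      using keep[of _ g] le3 u unfolding drdf_iff_defended g_def by auto
    moreover have "sum g (V - {u, v}) = sum f (V - {u, v})"
      by (rule sum.cong) (auto simp: g_def)
    then have "sum g V < sum f V"
      using sum_split[of g] sum_split[of f] True \<open>f v \<ge> 2\<close> \<open>u \<noteq> v\<close> by (simp add: g_def)
    ultimately show ?thesis by blast
  next
    case False
    \<comment> \<open>The pair \<open>u\<close>, \<open>v\<close> now weighs 3, against at least 2 +
      2 under \<open>f\<close>.\<close>
    define g where "g = f(u := 3, v := 0)"
    have "u \<in> neighborhood E v"
      using uv unfolding neighborhood_def by simp
    then have "defended (neighborhood E v) g 0"
      using \<open>u \<noteq> v\<close> unfolding defended_def g_def by auto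
    moreover have "defended (neighborhood E u) g 3"
      unfolding defended_def by simp
    ultimately have "drdf V E g"
      using keep[of _ g] le3 u unfolding drdf_iff_defended g_def by auto
    moreover have "sum g (V - {u, v}) = sum f (V - {u, v})"
      by (rule sum.cong) (auto simp: g_def)
    then have "sum g V < sum f V"
      using sum_split[of g] sum_split[of f] False \<open>f v \<ge> 2\<close> \<open>u \<noteq> v\<close> by (simp add: g_def)
    ultimately show ?thesis by blast
  qed
  then show ?thesis
    using gamma gamma_dR_le by (metis le_less_trans)
qed

theorem theorem3p5:
  fixes V :: "'a set" and E :: "'a set set" and u v :: 'a
  assumes "fin_simple_graph V E"
    and "connected_graph V E"
    and "card V \<ge> 2"
    and "{u, v} \<in> E"
  shows "b_dR V E \<le>
    enat (degree E u + degree E v - 1 - card (neighborhood E u \<inter> neighborhood E v))"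
proof -
  interpret fin_simple_graph V E by fact
  let ?N = "neighborhood E"
  \<comment> \<open>The edge between \<open>u\<close> and \<open>v\<close> is already deleted on the
    side of \<open>v\<close>; leaving \<open>v\<close> out of \<open>P\<close> counts it once and
    yields the \<open>- 1\<close> in the bound.\<close>
  define P where "P = ?N u - ?N v - {v}"
  define B where "B = (\<lambda>x. {x, v}) ` ?N v \<union> (\<lambda>x. {x, u}) ` P"
  have "B \<subseteq> E"
    unfolding B_def P_def neighborhood_def by auto
  have "neighborhood (E - B) v = {}"
    unfolding B_def neighborhood_def by auto
  moreover have "neighborhood (E - B) u \<subseteq> ?N v"
  proof
    fix x assume x: "x \<in> neighborhood (E - B) u"
    then have "{x, u} \<in> E" "{x, u} \<notin> B"
      unfolding neighborhood_def by auto
    moreover have "{v, u} \<in> B"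
      using assms(4) unfolding B_def neighborhood_def by (auto simp: insert_commute)
    ultimately show "x \<in> ?N v"
      unfolding B_def P_def neighborhood_def by blast
  qed
  ultimately have "gamma_dR V E < gamma_dR V (E - B)"
    using assms(4) by (intro gamma_dR_less_if_isolated) auto
  then have "b_dR V E \<le> enat (card B)"
    unfolding b_dR_def using \<open>B \<subseteq> E\<close> by (intro Inf_lower) blast
  moreover have "card B \<le> degree E u + degree E v - 1 - card (?N u \<inter> ?N v)"
  proof -
    have v: "v \<in> ?N u - ?N v"
      using assms(4) not_in_own_neighborhood unfolding neighborhood_def
      by (auto simp: insert_commute)
    have "finite P"
      using finite_neighborhood unfolding P_def by blast
    have "card B \<le> card (?N v) + card P"
      unfolding B_def
      by (rule order_trans[OF card_Un_le])
        (intro add_mono card_image_le finite_neighborhood \<open>finite P\<close>)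
    moreover have "card P = card (?N u - ?N v) - 1"
      using v unfolding P_def by simp
    moreover have "card (?N u - ?N v) = card (?N u) - card (?N u \<inter> ?N v)"
      using finite_neighborhood by (simp add: card_Diff_subset_Int)
    \<comment> \<open>Positivity makes the truncated subtraction of 1 in \<open>card P\<close>
      exact.\<close>
    moreover have "card (?N u - ?N v) > 0"
      using v finite_neighborhood by (metis card_gt_0_iff empty_iff finite_Diff)
    ultimately show ?thesis
      unfolding degree_def by linarith
  qed
  ultimately show ?thesis
    by (meson enat_ord_simps(1) order_trans)
qed

end
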